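(* Let $n\ge 1$, let $P,Q\in D_n$ and let $C(P,Q)=\{x_0,x_1,\ldots,x_k\}$ be the crossing set of $(P,Q)$, with $x_0<x_1<\cdots<x_k$ (so $x_0=0$ and $x_k=2n$). Then the relative pseudocomplement $P\rightsquigarrow Q\in D_n$ is the Dyck path constructed as follows, for $0\le i\le k-1$: (1) if $i$ is even, then the portion of $P\rightsquigarrow Q$ between abscissas $x_i$ and $x_{i+1}$ is the unique subpath of the form $u^{\alpha}d^{\beta}$ ($\alpha,\beta$ suitable nonnegative integers) whose starting and ending points are the same as those of $P$ and $Q$ at abscissas $x_i$ and $x_{i+1}$; (2) if $i$ is odd, then $P\rightsquigarrow Q$ coincides with $Q$ between abscissas $x_i$ and $x_{i+1}$.
   Context: A Dyck path of semilength $n$ is a lattice path from $(0,0)$ to $(2n,0)$ using steps $u=(1,1)$ and $d=(1,-1)$ and never going below the $x$-axis. $D_n$ is the set of Dyck paths of semilength $n$, partially ordered by $P\le Q$ iff $P$ lies weakly below $Q$; it is a finite distributive lattice, hence a Heyting algebra in which the relative pseudocomplement of $P$ with respect to $Q$ is $P\rightsquigarrow Q=\bigvee\{Z\in D_n : P\wedge Z\le Q\}$. For $P,Q\in D_n$, the crossing set $C(P,Q)\subseteq\{0,1,\ldots,2n\}$ is defined by: $x\in C(P,Q)$ iff exactly one of the following conditions holds: (1) $x\in\{0,2n\}$; (2) $P$ and $Q$ have a common point with abscissa $x$, $P$ has an up step starting at that point and $Q$ has a down step starting at that point; (3) $P$ and $Q$ have a common point with abscissa $x$, $P$ has a down step arriving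 at that point and $Q$ has an up step arriving at that point. *)

theory Defs
  imports "HOL-Algebra.Complete_Lattice"
begin

datatype step = U | D

fun step_vec :: "step \<Rightarrow> int \<times> int" where
  "step_vec U = (1, 1)"
| "step_vec D = (1, -1)"

fun end_point :: "int \<times> int \<Rightarrow> step list \<Rightarrow> int \<times> int" where
  "end_point A [] = A"
| "end_point A (s # w) = end_point (fst A + fst (step_vec s), snd A + snd (step_vec s)) w"

(* A path starting at the origin is given by its list of steps. *)
definition point :: "step list \<Rightarrow> nat \<Rightarrow> int \<times> int" where
  "point P x = end_point (0, 0) (take x P)"

definition dyck_paths :: "nat \<Rightarrow> step list set" where
  "dyck_paths n = {P. end_point (0, 0) P = (2 * int n, 0) \<and>
                      (\<forall>x \<le> length P. 0 \<le> snd (point P x))}"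

(* Paths are linear between consecutive integer abscissas, so "weakly below" can be
   tested at integer abscissas. *)
definition dyck_lattice :: "nat \<Rightarrow> step list gorder" where
  "dyck_lattice n =
     \<lparr>carrier = dyck_paths n, eq = (=),
      le = (\<lambda>P Q. \<forall>x \<le> 2 * n. snd (point P x) \<le> snd (point Q x))\<rparr>"

definition rel_pseudocomplement :: "nat \<Rightarrow> step list \<Rightarrow> step list \<Rightarrow> step list" where
  "rel_pseudocomplement n P Q =
     \<Squnion>\<^bsub>dyck_lattice n\<^esub>
       {Z \<in> dyck_paths n. (P \<sqinter>\<^bsub>dyck_lattice n\<^esub> Z) \<sqsubseteq>\<^bsub>dyck_lattice n\<^esub> Q}"

definition step_starting_at :: "step list \<Rightarrow> nat \<Rightarrow> step \<Rightarrow> bool" where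
  "step_starting_at P x s \<longleftrightarrow> x < length P \<and> P ! x = s"

definition step_arriving_at :: "step list \<Rightarrow> nat \<Rightarrow> step \<Rightarrow> bool" where
  "step_arriving_at P x s \<longleftrightarrow> 0 < x \<and> x \<le> length P \<and> P ! (x - 1) = s"

definition exactly_one :: "bool \<Rightarrow> bool \<Rightarrow> bool \<Rightarrow> bool" where
  "exactly_one a b c \<longleftrightarrow> (a \<and> \<not> b \<and> \<not> c) \<or> (\<not> a \<and> b \<and> \<not> c) \<or> (\<not> a \<and> \<not> b \<and> c)"

definition crossing_set :: "nat \<Rightarrow> step list \<Rightarrow> step list \<Rightarrow> nat set" where
  "crossing_set n P Q = {x \<in> {0..2 * n}.
     exactly_one
       (x \<in> {0, 2 * n})
       (point P x = point Q x \<and> step_starting_at P x U \<and> step_starting_at Q x D)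
       (point P x = point Q x \<and> step_arriving_at P x D \<and> step_arriving_at Q x U)}"

definition portion :: "step list \<Rightarrow> nat \<Rightarrow> nat \<Rightarrow> step list" where
  "portion P a b = take (b - a) (drop a P)"

(* S lists only steps; as a path it is read starting from the point A. *)
definition peak_subpath :: "int \<times> int \<Rightarrow> int \<times> int \<Rightarrow> step list \<Rightarrow> bool" where
  "peak_subpath A B S \<longleftrightarrow>
     (\<exists>\<alpha> \<beta>. S = replicate \<alpha> U @ replicate \<beta> D) \<and> end_point A S = B"

end

theory Submission
  imports Defs
begin

text \<open>The candidates \<open>Z\<close> in the definition of the relative pseudocomplement are the paths that lie below
  \<open>Q\<close> wherever \<open>P\<close> exceeds \<open>Q\<close>. The crossings are the places where an edge on which \<open>P\<close> exceeds
  \<open>Q\<close> meets one on which it does not; as \<open>P\<close> does not exceed \<open>Q\<close> on the first edge, it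
  exceeds \<open>Q\<close> exactly on the edges of the odd intervals. There the largest candidate is \<open>Q\<close>; on an
  even interval only the values at the ends constrain it, so it climbs as long as possible and then
  descends.\<close>

section \<open>Heights of lattice paths\<close>

definition height :: "step list \<Rightarrow> nat \<Rightarrow> int" where
  "height P y = snd (point P y)"

lemma fst_end_point: "fst (end_point A w) = fst A + int (length w)"
proof (induction w arbitrary: A)
  case (Cons s w)
  then show ?case by (cases s) simp_all
qed simp

lemma end_point_append: "end_point A (v @ w) = end_point (end_point A v) w"
  by (induction v arbitrary: A) simp_all

lemma point_0: "point P 0 = (0, 0)"
  by (simp add: point_def)

lemma point_Suc:
  assumes "y < length P"
  shows "point P (Suc y) = end_point (point P y) [P ! y]"
  using assms by (simp only: point_def take_Suc_conv_app_nth end_point_append)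

lemma point_eq_height: "y \<le> length P \<Longrightarrow> point P y = (int y, height P y)"
  by (simp add: prod_eq_iff height_def point_def fst_end_point)

lemma height_0 [simp]: "height P 0 = 0"
  by (simp add: height_def point_0)

lemma height_Suc:
  "y < length P \<Longrightarrow> height P (Suc y) = height P y + (if P ! y = U then 1 else - 1)"
  by (cases "P ! y") (simp_all add: height_def point_Suc)

lemma height_lipschitz:
  assumes "y \<le> z" "z \<le> length P"
  shows "\<bar>height P z - height P y\<bar> \<le> int z - int y"
  using assms
proof (induction z rule: dec_induct)
  case (step z)
  then show ?case using height_Suc[of z P] by (auto split: if_splits)
qed simp

text \<open>Each step changes both the height and the abscissa by one. Hence two paths have heights
  of equal parity at each abscissa, and distinct heights there differ by at least 2.\<close>

lemma even_height: "y \<le> length P \<Longrightarrow> even (height P y + int y)"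
  by (induction y) (auto simp: height_Suc)

section \<open>Dyck paths described by their heights\<close>

lemma dyck_paths_iff:
  "P \<in> dyck_paths n \<longleftrightarrow>
     length P = 2 * n \<and> height P (2 * n) = 0 \<and> (\<forall>y\<le>2 * n. 0 \<le> height P y)"
proof -
  have "end_point (0, 0) P = (2 * int n, 0) \<longleftrightarrow> length P = 2 * n \<and> height P (2 * n) = 0"
    using fst_end_point[of "(0, 0)" P] by (auto simp: prod_eq_iff height_def point_def)
  then show ?thesis
    by (auto simp: dyck_paths_def height_def)
qed

lemma dyck_path_eqI:
  assumes "P \<in> dyck_paths n" "Q \<in> dyck_paths n"
    and "\<And>y. y \<le> 2 * n \<Longrightarrow> height P y = height Q y"
  shows "P = Q"
proof (rule nth_equalityI)
  show "length P = length Q" using assms by (simp add: dyck_paths_iff)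
next
  fix y assume "y < length P"
  then have "y < 2 * n" "y < length P" "y < length Q"
    using assms by (simp_all add: dyck_paths_iff)
  then have "P ! y = U \<longleftrightarrow> Q ! y = U"
    using assms(3)[of y] assms(3)[of "Suc y"] height_Suc[of y P] height_Suc[of y Q]
    by (auto split: if_splits)
  then show "P ! y = Q ! y" by (cases "P ! y"; cases "Q ! y") auto
qed

text \<open>The steps are read off from the signs of the increments of \<open>f\<close>. This allows
  meets and pseudocomplements to be constructed as height functions.\<close>

lemma dyck_path_with_heights:
  assumes "f 0 = 0" "f (2 * n) = 0"
    and step: "\<And>y. y < 2 * n \<Longrightarrow> \<bar>f (Suc y) - f y\<bar> = (1::int)"
    and nonneg: "\<And>y. y \<le> 2 * n \<Longrightarrow> 0 \<le> f y"
  obtains R where "R \<in> dyck_paths n" "\<And>y. y \<le> 2 * n \<Longrightarrow> height R y = f y"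
proof -
  define R where "R = map (\<lambda>y. if f y < f (Suc y) then U else D) [0..<2 * n]"
  have "height R y = f y" if "y \<le> 2 * n" for y
    using that
  proof (induction y)
    case (Suc y)
    then show ?case using step[of y] by (auto simp: height_Suc R_def)
  qed (simp add: assms)
  moreover from this have "R \<in> dyck_paths n"
    using assms by (simp add: dyck_paths_iff) (simp add: R_def)
  ultimately show ?thesis using that by blast
qed

section \<open>Peak-shaped subpaths\<close>

lemma peak_subpath_unique:
  assumes "peak_subpath A B S" "peak_subpath A B T"
  shows "S = T"
proof -
  have end_point_up: "end_point A (replicate a U) = (fst A + int a, snd A + int a)" for a A
    by (induction a arbitrary: A) simp_all
  have end_point_down: "end_point A (replicate a D) = (fst A + int a, snd A - int a)" for a A
    by (induction a arbitrary: A) simp_all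
  \<comment> \<open>The end points determine \<alpha> + \<beta> and \<alpha> - \<beta>, hence both
    exponents.\<close>
  show ?thesis
    using assms by (auto simp: peak_subpath_def end_point_append end_point_up end_point_down)
qed

lemma peak_subpath_portion:
  assumes "a \<le> b" "b \<le> length R"
    and peak: "\<And>y. a \<le> y \<Longrightarrow> y \<le> b \<Longrightarrow>
      height R y = min (height R a + (int y - int a)) (height R b + (int b - int y))"
  shows "peak_subpath (point R a) (point R b) (portion R a b)"
proof -
  have "take b R = take a R @ portion R a b"
    using assms(1,2) by (metis append_take_drop_id le_add_diff_inverse portion_def take_add)
  then have ends: "end_point (point R a) (portion R a b) = point R b"
    by (simp add: point_def end_point_append)
  \<comment> \<open>The number \<alpha> of up steps has to be half of rise plus width: parity makes
    this an integer, and the Lipschitz bound places it between 0 and \<open>b - a\<close>.\<close>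
  have "even (height R b - height R a + (int b - int a))"
    using even_height[of a R] even_height[of b R] assms(1,2) by presburger
  moreover have "\<bar>height R b - height R a\<bar> \<le> int b - int a"
    using height_lipschitz[of a b R] assms(1,2) by simp
  moreover from calculation(1) obtain m where "height R b - height R a + (int b - int a) = 2 * m"
    by (elim evenE)
  ultimately obtain \<alpha> where
    \<alpha>: "2 * int \<alpha> = height R b - height R a + (int b - int a)" "\<alpha> \<le> b - a"
    using that[of "nat m"] by simp
  have "portion R a b = replicate \<alpha> U @ replicate (b - a - \<alpha>) D"
  proof (rule nth_equalityI)
    show "length (portion R a b) = length (replicate \<alpha> U @ replicate (b - a - \<alpha>) D)"
      using assms(1,2) \<alpha> by (simp add: portion_def)
  next
    fix j assume "j < length (portion R a b)"
    then have j: "j < b - a" by (simp add: portion_def)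
    then have "height R (Suc (a + j)) = height R (a + j) + (if R ! (a + j) = U then 1 else - 1)"
      using assms(1,2) j by (intro height_Suc) linarith
    moreover have
      "height R (a + j) = min (height R a + int j) (height R b + (int (b - a) - int j))"
      "height R (Suc (a + j)) = min (height R a + int j + 1) (height R b + (int (b - a) - int j - 1))"
      using peak[of "a + j"] peak[of "Suc (a + j)"] j by (simp_all add: algebra_simps of_nat_diff)
    \<comment> \<open>The rising line from the left end and the falling line to the right end meet
      at abscissa \<open>a + \<alpha>\<close>, so the minimum turns there.\<close>
    ultimately have "R ! (a + j) = U \<longleftrightarrow> j < \<alpha>"
      using \<alpha> j by (auto split: if_splits simp: min_def of_nat_diff)
    then have "R ! (a + j) = (if j < \<alpha> then U else D)"
      by (cases "R ! (a + j)") auto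
    then show "portion R a b ! j = (replicate \<alpha> U @ replicate (b - a - \<alpha>) D) ! j"
      using j assms(1,2) by (auto simp: portion_def nth_append)
  qed
  with ends show ?thesis unfolding peak_subpath_def by blast
qed

section \<open>The lattice of Dyck paths and its relative pseudocomplement\<close>

lemma dyck_lattice_simps [simp]:
  "carrier (dyck_lattice n) = dyck_paths n"
  "P \<sqsubseteq>\<^bsub>dyck_lattice n\<^esub> Q \<longleftrightarrow> (\<forall>y\<le>2 * n. height P y \<le> height Q y)"
  by (simp_all add: dyck_lattice_def height_def)

lemma dyck_lattice_eq [simp]: "(.=\<^bsub>dyck_lattice n\<^esub>) = (=)"
  by (simp add: dyck_lattice_def)

lemma partial_order_dyck_lattice: "partial_order (dyck_lattice n)"
proof
  show "(.=\<^bsub>dyck_lattice n\<^esub>) = (=)" by simp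
qed (auto intro: order_trans intro!: dyck_path_eqI[where n = n] order_antisym)

text \<open>The pointwise minimum is itself the height function of a Dyck path, hence the greatest
  lower bound. It could stay constant across an edge only if the two heights differed by one, which
  parity excludes.\<close>

lemma height_meet:
  assumes P: "P \<in> dyck_paths n" and Q: "Q \<in> dyck_paths n" and "y \<le> 2 * n"
  shows "height (P \<sqinter>\<^bsub>dyck_lattice n\<^esub> Q) y = min (height P y) (height Q y)"
proof -
  interpret partial_order "dyck_lattice n" by (rule partial_order_dyck_lattice)
  have "\<bar>min (height P (Suc y)) (height Q (Suc y)) - min (height P y) (height Q y)\<bar> = 1"
    if "y < 2 * n" for y
  proof -
    have "y < length P" "y < length Q" using that P Q by (simp_all add: dyck_paths_iff)
    moreover from this have
      "height P y = height Q y \<or> height P y + 2 \<le> height Q y \<or> height Q y + 2 \<le> height P y"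
      using even_height[of y P] even_height[of y Q] by presburger
    ultimately show ?thesis by (auto simp: height_Suc)
  qed
  then obtain M where M: "M \<in> dyck_paths n"
    "\<And>y. y \<le> 2 * n \<Longrightarrow> height M y = min (height P y) (height Q y)"
    using P Q unfolding dyck_paths_iff
    by (rule_tac dyck_path_with_heights[of "\<lambda>y. min (height P y) (height Q y)" n])
      (auto simp: dyck_paths_iff)
  have "greatest (dyck_lattice n) M (Lower (dyck_lattice n) {P, Q})"
    using M P Q by (auto simp: greatest_def Lower_def)
  then have "P \<sqinter>\<^bsub>dyck_lattice n\<^esub> Q = M"
    unfolding meet_def inf_def by (blast intro: greatest_unique)
  then show ?thesis using M assms by simp
qed

text \<open>A minimum of \<open>P\<close> and \<open>Z\<close> is at most \<open>Q\<close> unless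
  both exceed \<open>Q\<close>, so \<open>Z\<close> is constrained only where \<open>P\<close>
  exceeds \<open>Q\<close>. The assumptions make \<open>R\<close> the largest such \<open>Z\<close>,
  so the supremum is attained.\<close>

lemma rel_pseudocomplement_eqI:
  assumes P: "P \<in> dyck_paths n" and R: "R \<in> dyck_paths n"
    and le: "\<And>y. y \<le> 2 * n \<Longrightarrow> height Q y < height P y \<Longrightarrow> height R y \<le> height Q y"
    and max: "\<And>Z y. Z \<in> dyck_paths n \<Longrightarrow> y \<le> 2 * n \<Longrightarrow>
      (\<And>z. z \<le> 2 * n \<Longrightarrow> height Q z < height P z \<Longrightarrow> height Z z \<le> height Q z) \<Longrightarrow>
      height Z y \<le> height R y"
  shows "rel_pseudocomplement n P Q = R"
proof -
  interpret partial_order "dyck_lattice n" by (rule partial_order_dyck_lattice)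
  let ?S = "{Z \<in> dyck_paths n. (P \<sqinter>\<^bsub>dyck_lattice n\<^esub> Z) \<sqsubseteq>\<^bsub>dyck_lattice n\<^esub> Q}"
  have S: "Z \<in> ?S \<longleftrightarrow> Z \<in> dyck_paths n \<and>
      (\<forall>y\<le>2 * n. height Q y < height P y \<longrightarrow> height Z y \<le> height Q y)" for Z
    using P by (auto simp: height_meet min_le_iff_disj not_less)
  have "R \<in> ?S" using R le by (subst S) blast
  moreover have "Z \<sqsubseteq>\<^bsub>dyck_lattice n\<^esub> R" if "Z \<in> ?S" for Z
  proof -
    have "Z \<in> dyck_paths n" "\<And>z. z \<le> 2 * n \<Longrightarrow> height Q z < height P z \<Longrightarrow> height Z z \<le> height Q z"
      using that unfolding S by blast+
    from max[OF this(1) _ this(2)] show ?thesis by simp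
  qed
  ultimately have "least (dyck_lattice n) R (Upper (dyck_lattice n) ?S)"
    using R by (intro least_UpperI) (auto simp: Upper_def simp del: dyck_lattice_simps(2))
  then show ?thesis
    unfolding rel_pseudocomplement_def sup_def by (blast intro: least_unique)
qed

text \<open>Paths being 1-Lipschitz, the largest candidate is the lower envelope of the cones with apex on
  \<open>Q\<close> at the abscissas where \<open>P\<close> exceeds \<open>Q\<close> and at the two ends; equal parities make its
  slopes \<open>1\<close> or \<open>- 1\<close>.\<close>

lemma rel_pseudocomplement_envelope:
  fixes P Q :: "step list"
  assumes P: "P \<in> dyck_paths n" and Q: "Q \<in> dyck_paths n"
  defines "R \<equiv> rel_pseudocomplement n P Q"
  shows "R \<in> dyck_paths n"
    and "\<And>y. y \<le> 2 * n \<Longrightarrow> height Q y \<le> height R y"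
    and "\<And>y. y \<le> 2 * n \<Longrightarrow> height Q y < height P y \<Longrightarrow> height R y = height Q y"
    and "\<And>y. y \<le> 2 * n \<Longrightarrow> \<exists>z\<le>2 * n. (z = 0 \<or> z = 2 * n \<or> height Q z < height P z) \<and>
      height R y = height Q z + \<bar>int y - int z\<bar>"
proof -
  \<comment> \<open>The two ends are included as apexes because all Dyck paths have height 0
    there.\<close>
  define A where "A = {0, 2 * n} \<union> {z. z \<le> 2 * n \<and> height Q z < height P z}"
  define f where "f y = Min ((\<lambda>z. height Q z + \<bar>int y - int z\<bar>) ` A)" for y
  have A: "finite A" "A \<noteq> {}" "\<And>z. z \<in> A \<Longrightarrow> z \<le> 2 * n" by (auto simp: A_def)
  have len: "length Q = 2 * n" and ends: "height Q (2 * n) = 0"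
    and nonneg: "\<And>y. y \<le> 2 * n \<Longrightarrow> 0 \<le> height Q y"
    using Q by (simp_all add: dyck_paths_iff)
  have f_le: "f y \<le> height Q z + \<bar>int y - int z\<bar>" if "z \<in> A" for y z
    unfolding f_def using A that by (auto intro: Min_le)
  have f_attained: "\<exists>z\<in>A. f y = height Q z + \<bar>int y - int z\<bar>" for y
    using Min_in[of "(\<lambda>z. height Q z + \<bar>int y - int z\<bar>) ` A"] A
    unfolding f_def[symmetric] by auto
  have lipschitz: "\<bar>height Z y - height Z z\<bar> \<le> \<bar>int y - int z\<bar>"
    if "Z \<in> dyck_paths n" "y \<le> 2 * n" "z \<le> 2 * n" for Z y z
    using height_lipschitz[of y z Z] height_lipschitz[of z y Z] that
    by (cases "y \<le> z") (auto simp: dyck_paths_iff)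
  \<comment> \<open>Being 1-Lipschitz, \<open>Q\<close> lies below every cone with apex on
    it.\<close>
  have f_ge: "height Q y \<le> f y" if y: "y \<le> 2 * n" for y
  proof -
    obtain z where "z \<in> A" "f y = height Q z + \<bar>int y - int z\<bar>" using f_attained by blast
    then show ?thesis using lipschitz[OF Q y, of z] A(3)[of z] by linarith
  qed
  have f_eq: "f z = height Q z" if "z \<in> A" for z
    using f_le[OF that, of z] f_ge[of z] A(3)[OF that] by simp
  \<comment> \<open>A cone attaining the minimum at one end of the edge bounds \<open>f\<close> at
    the other end.\<close>
  have f_step_le: "\<bar>f (Suc y) - f y\<bar> \<le> 1" for y
  proof -
    obtain z where "z \<in> A" "f y = height Q z + \<bar>int y - int z\<bar>" using f_attained by blast
    moreover obtain z' where "z' \<in> A" "f (Suc y) = height Q z' + \<bar>int (Suc y) - int z'\<bar>"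
      using f_attained by blast
    ultimately show ?thesis using f_le[of z "Suc y"] f_le[of z' y] by simp
  qed
  have f_parity: "even (f y + int y)" for y
  proof -
    obtain z where "z \<in> A" "f y = height Q z + \<bar>int y - int z\<bar>" using f_attained by blast
    then show ?thesis using even_height[of z Q] A(3)[of z] len by simp presburger
  qed
  \<comment> \<open>By parity the increment is odd, and it is at most 1 in absolute value.\<close>
  have "\<bar>f (Suc y) - f y\<bar> = 1" for y
    using f_step_le[of y] f_parity[of y] f_parity[of "Suc y"] by simp presburger
  moreover have "f 0 = 0" "f (2 * n) = 0"
    using f_eq[of 0] f_eq[of "2 * n"] ends by (simp_all add: A_def)
  moreover have "0 \<le> f y" if "y \<le> 2 * n" for y
    using f_ge[OF that] nonneg[OF that] by simp
  ultimately obtain S where S: "S \<in> dyck_paths n" "\<And>y. y \<le> 2 * n \<Longrightarrow> height S y = f y"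
    using dyck_path_with_heights[of f n] by blast
  have "R = S"
    unfolding R_def
  proof (rule rel_pseudocomplement_eqI[OF P S(1)])
    show "height S y \<le> height Q y" if "y \<le> 2 * n" "height Q y < height P y" for y
      using that S(2)[of y] f_eq[of y] by (simp add: A_def)
  next
    fix Z y
    assume Z: "Z \<in> dyck_paths n" and y: "y \<le> 2 * n"
      and below: "\<And>z. z \<le> 2 * n \<Longrightarrow> height Q z < height P z \<Longrightarrow> height Z z \<le> height Q z"
    obtain z where z: "z \<in> A" "f y = height Q z + \<bar>int y - int z\<bar>" using f_attained by blast
    \<comment> \<open>At an end of the paths both heights vanish; at any other apex this is the
      constraint on candidates.\<close>
    have "height Z z \<le> height Q z"
      using z(1) below Z Q by (auto simp: A_def dyck_paths_iff)
    then show "height Z y \<le> height S y"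
      using lipschitz[OF Z y, of z] z A(3)[of z] S(2)[OF y] by linarith
  qed
  then show "R \<in> dyck_paths n" "\<And>y. y \<le> 2 * n \<Longrightarrow> height Q y \<le> height R y"
    "\<And>y. y \<le> 2 * n \<Longrightarrow> height Q y < height P y \<Longrightarrow> height R y = height Q y"
    using S f_ge f_eq by (simp_all add: A_def)
  show "\<exists>z\<le>2 * n. (z = 0 \<or> z = 2 * n \<or> height Q z < height P z) \<and>
      height R y = height Q z + \<bar>int y - int z\<bar>" if "y \<le> 2 * n" for y
    using f_attained[of y] S(2)[OF that] \<open>R = S\<close> unfolding A_def by auto
qed

text \<open>This concerns the edge from \<open>y\<close> to \<open>Suc y\<close>. One strict end
  suffices: for paths with heights of equal parity, \<open>P\<close> is then weakly above
  \<open>Q\<close> on the whole edge, possibly meeting it at the other end.\<close>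

definition exceeds_on_edge :: "step list \<Rightarrow> step list \<Rightarrow> nat \<Rightarrow> bool" where
  "exceeds_on_edge P Q y \<longleftrightarrow> height Q y < height P y \<or> height Q (Suc y) < height P (Suc y)"

section \<open>Crossings and the shape of the pseudocomplement between them\<close>

context
  fixes n :: nat and P Q :: "step list"
  assumes n: "n \<ge> 1" and P: "P \<in> dyck_paths n" and Q: "Q \<in> dyck_paths n"
begin

lemma length_paths: "length P = 2 * n" "length Q = 2 * n"
  using P Q by (simp_all add: dyck_paths_iff)

lemma height_ends: "height P (2 * n) = 0" "height Q (2 * n) = 0"
  using P Q by (simp_all add: dyck_paths_iff)

lemma point_eq_iff: "y \<le> 2 * n \<Longrightarrow> point P y = point Q y \<longleftrightarrow> height P y = height Q y"
  by (simp add: point_eq_height length_paths)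

lemma first_step: "P ! 0 = U" "Q ! 0 = U"
proof -
  have "0 \<le> height P (Suc 0)" "0 \<le> height Q (Suc 0)"
    using P Q n by (simp_all add: dyck_paths_iff)
  then show "P ! 0 = U" "Q ! 0 = U"
    using height_Suc[of 0 P] height_Suc[of 0 Q] n length_paths by (auto split: if_splits)
qed

lemma last_step: "Q ! (2 * n - 1) = D"
proof -
  have "0 \<le> height Q (2 * n - 1)"
    using Q by (simp add: dyck_paths_iff)
  then show ?thesis
    using height_Suc[of "2 * n - 1" Q] n length_paths height_ends
    by (cases "Q ! (2 * n - 1)") (auto split: if_splits)
qed

text \<open>Since \<open>exactly_one\<close> is exclusive, the other two conditions must fail at the
  ends: \<open>Q\<close> starts with an up step and arrives with a down step, no step arrives at 0,
  and none starts at \<open>2 * n\<close>.\<close>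

lemma ends_crossing: "0 \<in> crossing_set n P Q" "2 * n \<in> crossing_set n P Q"
  using first_step last_step n length_paths
  by (auto simp: crossing_set_def exactly_one_def step_starting_at_def step_arriving_at_def)

lemma crossing_le: "y \<in> crossing_set n P Q \<Longrightarrow> y \<le> 2 * n"
  by (simp add: crossing_set_def)

lemma crossing_common:
  assumes "y \<in> crossing_set n P Q"
  shows "height P y = height Q y"
  using assms P Q crossing_le[OF assms]
  by (auto simp: crossing_set_def exactly_one_def point_eq_iff dyck_paths_iff)

text \<open>If the heights differ at \<open>Suc y\<close>, both adjacent edges have the same status.
  If they agree, \<open>P\<close> exceeds \<open>Q\<close> on the right edge iff condition (2)
  holds, and on the left edge iff condition (3) holds.\<close>

lemma crossing_iff:
  assumes y: "Suc y < 2 * n"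
  shows "Suc y \<in> crossing_set n P Q \<longleftrightarrow> exceeds_on_edge P Q y \<noteq> exceeds_on_edge P Q (Suc y)"
proof -
  define p q where "p = height P (Suc y)" and "q = height Q (Suc y)"
  have cases: "p = q \<or> p + 2 \<le> q \<or> q + 2 \<le> p"
    using even_height[of "Suc y" P] even_height[of "Suc y" Q] y length_paths
    unfolding p_def q_def by presburger
  have steps: "height P (Suc (Suc y)) = p + (if P ! Suc y = U then 1 else - 1)"
    "height Q (Suc (Suc y)) = q + (if Q ! Suc y = U then 1 else - 1)"
    "height P y = p - (if P ! y = U then 1 else - 1)"
    "height Q y = q - (if Q ! y = U then 1 else - 1)"
    using y length_paths by (simp_all add: height_Suc p_def q_def)
  \<comment> \<open>At an interior abscissa the first condition is false, so
    \<open>exactly_one\<close> becomes the exclusive or of the other two.\<close>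
  have "Suc y \<in> crossing_set n P Q \<longleftrightarrow>
      p = q \<and> ((P ! Suc y = U \<and> Q ! Suc y = D) \<noteq> (P ! y = D \<and> Q ! y = U))"
    using y length_paths
    by (auto simp: crossing_set_def exactly_one_def point_eq_iff p_def q_def
        step_starting_at_def step_arriving_at_def)
  then show ?thesis
    using cases unfolding exceeds_on_edge_def steps p_def[symmetric] q_def[symmetric]
    by (cases "P ! Suc y"; cases "Q ! Suc y"; cases "P ! y"; cases "Q ! y") auto
qed

lemma not_exceeds_on_edge_0: "\<not> exceeds_on_edge P Q 0"
  using first_step n length_paths height_Suc[of 0 P] height_Suc[of 0 Q]
  by (simp add: exceeds_on_edge_def)

text \<open>Where \<open>P\<close> exceeds \<open>Q\<close>, the envelope equals \<open>Q\<close>.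
  If the paths meet at the other end of the edge, \<open>Q\<close> rises towards that end, and the
  envelope, which stays above \<open>Q\<close> and also changes by one, must rise with it.\<close>

lemma rel_pseudocomplement_on_edge:
  assumes y: "y < 2 * n" and "exceeds_on_edge P Q y"
  shows "height (rel_pseudocomplement n P Q) y = height Q y"
    and "height (rel_pseudocomplement n P Q) (Suc y) = height Q (Suc y)"
proof -
  let ?R = "rel_pseudocomplement n P Q"
  note R = rel_pseudocomplement_envelope[OF P Q]
  have len: "length ?R = 2 * n" using R(1) by (simp add: dyck_paths_iff)
  have steps: "height Z (Suc y) = height Z y + 1 \<or> height Z (Suc y) = height Z y - 1"
    if "length Z = 2 * n" for Z using that y height_Suc[of y Z] by auto
  have "even (height P y - height Q y)" "even (height P (Suc y) - height Q (Suc y))"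
    using even_height[of y P] even_height[of y Q] even_height[of "Suc y" P]
      even_height[of "Suc y" Q] y length_paths by presburger+
  then have "height Q y < height P y \<longrightarrow> height Q y + 2 \<le> height P y"
    "height Q (Suc y) < height P (Suc y) \<longrightarrow> height Q (Suc y) + 2 \<le> height P (Suc y)"
    by presburger+
  then show "height ?R y = height Q y" "height ?R (Suc y) = height Q (Suc y)"
    using assms R(2,3)[of y] R(2,3)[of "Suc y"] steps[OF len] steps[OF length_paths(1)]
      steps[OF length_paths(2)]
    unfolding exceeds_on_edge_def by auto
qed

text \<open>An interior crossing is an end of an edge on which \<open>P\<close> exceeds
  \<open>Q\<close>; at the ends of the paths both heights are 0.\<close>

lemma rel_pseudocomplement_at_crossing:
  assumes "y \<in> crossing_set n P Q"
  shows "height (rel_pseudocomplement n P Q) y = height Q y"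
proof -
  have "y = 0 \<or> y = 2 * n \<or> (\<exists>z. y = Suc z \<and> Suc z < 2 * n)"
    using crossing_le[OF assms] by (cases y) auto
  then show ?thesis
  proof (elim disjE exE conjE)
    fix z assume "y = Suc z" "Suc z < 2 * n"
    then show ?thesis
      using assms crossing_iff[of z] rel_pseudocomplement_on_edge[of z]
        rel_pseudocomplement_on_edge[of "Suc z"] by auto
  qed (use rel_pseudocomplement_envelope(1)[OF P Q] height_ends in \<open>auto simp: dyck_paths_iff\<close>)
qed

text \<open>The cone attaining the envelope has its apex outside the open interval. As
  \<open>Q\<close> is 1-Lipschitz, that cone is no lower on the interval than the cone from the
  nearer interval end; as \<open>R\<close> is 1-Lipschitz, it lies below the cones from both
  ends.\<close>

lemma rel_pseudocomplement_peak:
  assumes ab: "a < b" "a \<in> crossing_set n P Q" "b \<in> crossing_set n P Q"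
    and no_edge: "\<And>y. a \<le> y \<Longrightarrow> y < b \<Longrightarrow> \<not> exceeds_on_edge P Q y"
  shows "peak_subpath (point Q a) (point Q b) (portion (rel_pseudocomplement n P Q) a b)"
proof -
  define R where "R = rel_pseudocomplement n P Q"
  note R = rel_pseudocomplement_envelope[OF P Q, folded R_def]
  have len: "length R = 2 * n" using R(1) by (simp add: dyck_paths_iff)
  have at: "height R a = height Q a" "height R b = height Q b"
    using rel_pseudocomplement_at_crossing ab by (simp_all add: R_def)
  have b: "b \<le> 2 * n" using crossing_le ab by simp
  have "height R y = min (height R a + (int y - int a)) (height R b + (int b - int y))"
    if y: "a \<le> y" "y \<le> b" for y
  proof -
    obtain z where z: "z \<le> 2 * n" "z = 0 \<or> z = 2 * n \<or> height Q z < height P z"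
      "height R y = height Q z + \<bar>int y - int z\<bar>"
      using R(4)[of y] y b by auto
    \<comment> \<open>An apex strictly inside is neither 0 nor \<open>2 * n\<close>, so
      \<open>P\<close> would exceed \<open>Q\<close> on the edge starting there.\<close>
    have "\<not> (a < z \<and> z < b)"
      using z no_edge[of z] b by (auto simp: exceeds_on_edge_def)
    then have "z \<le> a \<or> b \<le> z" by linarith
    then show ?thesis
      using height_lipschitz[of z a Q] height_lipschitz[of b z Q] height_lipschitz[of a y R]
        height_lipschitz[of y b R] y b z ab len length_paths at
      by (auto simp: min_def)
  qed
  moreover have "a \<le> b" "b \<le> length R" using ab(1) b len by simp_all
  ultimately have "peak_subpath (point R a) (point R b) (portion R a b)"
    by (intro peak_subpath_portion)
  then show ?thesis
    using at ab b len length_paths by (simp add: point_eq_height R_def)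
qed

text \<open>The status of edges is constant between consecutive crossings, flips at each interior
  crossing, and is false on the first edge.\<close>

lemma exceeds_on_edge_between_crossings:
  assumes C: "crossing_set n P Q = x ` {0..k}" and x: "strict_mono_on {0..k} x" and x0: "x 0 = 0"
  shows "i < k \<Longrightarrow> x i \<le> y \<Longrightarrow> y < x (Suc i) \<Longrightarrow> exceeds_on_edge P Q y \<longleftrightarrow> odd i"
proof -
  have spread: "exceeds_on_edge P Q y \<longleftrightarrow> exceeds_on_edge P Q (x i)"
    if "i < k" "x i \<le> y" "y < x (Suc i)" for i y
    using that(2,3)
  proof (induction y rule: dec_induct)
    case (step y)
    have "Suc y \<notin> x ` {0..k}"
    proof
      assume "Suc y \<in> x ` {0..k}"
      then obtain j where "j \<le> k" "Suc y = x j" by auto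
      then have "x i < x j" "x j < x (Suc i)" using step by simp_all
      then have "i < j" "j < Suc i"
        using x \<open>j \<le> k\<close> \<open>i < k\<close> by (simp_all add: strict_mono_on_less)
      then show False by simp
    qed
    moreover have "x (Suc i) \<le> 2 * n" using C crossing_le that(1) by simp
    ultimately show ?case using crossing_iff[of y] step C by simp
  qed simp
  show "i < k \<Longrightarrow> x i \<le> y \<Longrightarrow> y < x (Suc i) \<Longrightarrow> exceeds_on_edge P Q y \<longleftrightarrow> odd i"
  proof (induction i arbitrary: y)
    case 0
    then show ?case using spread[of 0 y] not_exceeds_on_edge_0 x0 by simp
  next
    case (Suc i)
    have mono: "x i < x (Suc i)" "x (Suc i) < x (Suc (Suc i))"
      using Suc.prems(1) by (auto intro!: strict_mono_onD[OF x])
    \<comment> \<open>The edge starting at \<open>z\<close> is the last one of the preceding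
      interval.\<close>
    then obtain z where z: "x (Suc i) = Suc z" by (cases "x (Suc i)") auto
    have "x (Suc i) \<in> crossing_set n P Q" "x (Suc (Suc i)) \<le> 2 * n"
      using C crossing_le Suc.prems(1) by simp_all
    moreover have "exceeds_on_edge P Q z \<longleftrightarrow> odd i" using Suc mono z by simp
    ultimately have "exceeds_on_edge P Q (x (Suc i)) \<longleftrightarrow> odd (Suc i)"
      using crossing_iff[of z] mono z by simp
    then show ?case using spread[of "Suc i" y] Suc.prems by simp
  qed
qed

end

theorem proposition2p1:
  fixes n k :: nat and P Q :: "step list" and x :: "nat \<Rightarrow> nat"
  assumes "n \<ge> 1"
    and "P \<in> dyck_paths n" and "Q \<in> dyck_paths n"
    and "crossing_set n P Q = x ` {0..k}" and "strict_mono_on {0..k} x"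
  defines "R \<equiv> rel_pseudocomplement n P Q"
  shows "x 0 = 0 \<and> x k = 2 * n \<and>
    (\<forall>i\<le>k. point P (x i) = point Q (x i)) \<and>
    R \<in> dyck_paths n \<and>
    (\<forall>i<k. even i \<longrightarrow>
        (\<exists>!S. peak_subpath (point Q (x i)) (point Q (x (i + 1))) S) \<and>
        point R (x i) = point Q (x i) \<and>
        peak_subpath (point Q (x i)) (point Q (x (i + 1))) (portion R (x i) (x (i + 1)))) \<and>
    (\<forall>i<k. odd i \<longrightarrow>
        (\<forall>y\<in>{x i..x (i + 1)}. point R y = point Q y))"
proof -
  note P = assms(2) and Q = assms(3) and C = assms(4) and x = assms(5)
  note context_assms = assms(1) P Q
  note R = rel_pseudocomplement_envelope[OF P Q, folded R_def]
  have len: "length P = 2 * n" "length Q = 2 * n" "length R = 2 * n"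
    using P Q R(1) by (simp_all add: dyck_paths_iff)
  have crossing: "x i \<in> crossing_set n P Q" if "i \<le> k" for i
    using C that by simp
  then have le: "x i \<le> 2 * n" if "i \<le> k" for i
    using crossing_le[OF context_assms] that by blast
  have at_P: "point P (x i) = point Q (x i)" if "i \<le> k" for i
    using crossing_common[OF context_assms crossing[OF that]] le[OF that] len
    by (simp add: point_eq_height)
  have at_R: "point R (x i) = point Q (x i)" if "i \<le> k" for i
    using rel_pseudocomplement_at_crossing[OF context_assms crossing[OF that]] le[OF that] len
    by (simp add: point_eq_height R_def)
  have mono: "x i < x (Suc i)" if "i < k" for i
    using that by (auto intro!: strict_mono_onD[OF x])
  have x_mono: "x i \<le> x j" if "i \<le> j" "j \<le> k" for i j
    using that x by (simp add: strict_mono_on_less_eq)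
  \<comment> \<open>Both extreme abscissas are crossings, hence values of \<open>x\<close>, and
    monotonicity puts them first and last.\<close>
  have ends: "x 0 = 0" "x k = 2 * n"
  proof -
    obtain i j where "i \<le> k" "x i = 0" "j \<le> k" "x j = 2 * n"
      using ends_crossing[OF context_assms] unfolding C by (metis atLeastAtMost_iff imageE)
    then show "x 0 = 0" "x k = 2 * n"
      using x_mono[of 0 i] x_mono[of j k] le[of k] by auto
  qed
  note edges = exceeds_on_edge_between_crossings[OF context_assms C x ends(1)]
  have even_case: "peak_subpath (point Q (x i)) (point Q (x (i + 1))) (portion R (x i) (x (i + 1)))"
    if "i < k" "even i" for i
    using rel_pseudocomplement_peak[OF context_assms mono crossing crossing] edges that
    by (simp add: R_def)
  have odd_case: "point R y = point Q y" if "i < k" "odd i" "y \<in> {x i..x (i + 1)}" for i y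
  \<comment> \<open>The right end starts no edge of the interval, so it is handled as a
    crossing.\<close>
  proof (cases "y = x (i + 1)")
    case True
    then show ?thesis using at_R[of "i + 1"] that by simp
  next
    case False
    then have "y < x (Suc i)" "x i \<le> y" "y < 2 * n"
      using that le[of "Suc i"] by simp_all
    then show ?thesis
      using edges[of i y] rel_pseudocomplement_on_edge(1)[OF context_assms, of y] that len
      by (simp add: point_eq_height R_def)
  qed
  have "\<exists>!S. peak_subpath (point Q (x i)) (point Q (x (i + 1))) S" if "i < k" "even i" for i
    using even_case[OF that] peak_subpath_unique by blast
  then show ?thesis
    using ends at_P at_R R(1) even_case odd_case by simp
qed

end
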